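(* The partition function $Z_0(\hbar)=\mathcal{F}\left[-\frac{x^2}{2}+\frac{x^4}{4!}\right](\hbar)$ of zero-dimensional $\varphi^4$-theory has a factorial asymptotic expansion with $A=\frac32$, $\beta=0$: for every $R\ge0$, as $n\to\infty$, $$[\hbar^n]Z_0(\hbar)=\sum_{k=0}^{R-1}c_k\left(\tfrac32\right)^{-n+k}\Gamma(n-k)+\mathcal{O}\left(\left(\tfrac32\right)^{-n}\Gamma(n-R)\right),$$ where $$\sum_{k\ge0}c_k\hbar^k=\frac1\pi\,\mathcal{F}\left[-x^2+\frac{x^3}{\sqrt{3!}}-\frac{x^4}{4!}\right](-\hbar)=\frac{1}{\sqrt2\,\pi}\left(1-\frac18\hbar+\frac{35}{384}\hbar^2-\frac{385}{3072}\hbar^3+\frac{25025}{98304}\hbar^4+\cdots\right).$$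
   Context: For $\mathcal{S}(x)=-\frac{x^2}{2a}+V(x)$ with $a>0$ and $V\in x^3\mathbb{R}[[x]]$, the formal integral is the formal power series $$\mathcal{F}[\mathcal{S}(x)](\hbar)=\sqrt{a}\sum_{n=0}^\infty (a\hbar)^n(2n-1)!!\,[x^{2n}]e^{\frac1\hbar V(x)},\qquad(-1)!!=1.$$ $\mathcal{F}[\cdot](-\hbar)$ means substituting $-\hbar$ for $\hbar$ in this series. *)

theory Defs
  imports
    "HOL-Analysis.Analysis"
    "HOL-Computational_Algebra.Formal_Laurent_Series"
    "HOL-Library.Landau_Symbols"
begin

text \<open>
  The formal variable \<open>x\<close> is the variable of the power series type \<open>_ fps\<close>, and \<open>\<hbar>\<close> is the variable
  \<^const>\<open>fls_X\<close> of \<^typ>\<open>real fls\<close> (and \<^const>\<open>fps_X\<close> of \<^typ>\<open>real fps\<close> once no negative powers of \<open>\<hbar>\<close>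
  are left). In \<open>exp (V(x) / \<hbar>)\<close> each coefficient of a power of \<open>x\<close> is a polynomial in \<open>1/\<hbar>\<close>, so this
  is a power series in \<open>x\<close> over the field of formal Laurent series in \<open>\<hbar>\<close>.
\<close>

definition exp_over_hbar :: "real fps \<Rightarrow> real fls fps" where
  "exp_over_hbar V = fps_exp 1 oo Abs_fps (\<lambda>n. fls_const (V $ n) / fls_X)"

text \<open>\<open>(2n-1)!!\<close>, with \<open>(-1)!! = 1\<close>.\<close>

definition odd_double_fact :: "nat \<Rightarrow> nat" where
  "odd_double_fact n = (\<Prod>i=1..n. 2 * i - 1)"

definition formal_integral_term :: "real \<Rightarrow> real fps \<Rightarrow> nat \<Rightarrow> real fls" where
  "formal_integral_term a V n =
     (fls_const a * fls_X) ^ n * of_nat (odd_double_fact n) * exp_over_hbar V $ (2 * n)"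

text \<open>
  \<open>\<F>[S(x)](\<hbar>)\<close>, for \<open>S(x) = - x\<^sup>2 / (2a) + V(x)\<close> with \<open>a > 0\<close> and \<open>V\<close> divisible by \<open>x\<^sup>3\<close>. Both \<open>a\<close> and
  \<open>V\<close> are recovered from \<open>S\<close>; the value is meaningful only if \<open>S $ 0 = S $ 1 = 0\<close> and \<open>S $ 2 < 0\<close>.
  The sum converges in the \<open>\<hbar>\<close>-adic metric of \<^typ>\<open>real fls\<close>, and taking \<^const>\<open>fls_regpart\<close> loses
  nothing; see \<open>formal_integral_sums\<close> below.
\<close>

definition formal_integral :: "real fps \<Rightarrow> real fps" where
  "formal_integral S =
     (let a = - 1 / (2 * S $ 2);
          V = S + fps_const (1 / (2 * a)) * fps_X ^ 2
      in fls_regpart (fls_const (sqrt a) * (\<Sum>n. formal_integral_term a V n)))"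

definition phi4_partition_function :: "real fps" where
  "phi4_partition_function =
     formal_integral (- fps_const (1 / 2) * fps_X ^ 2 + fps_const (1 / fact 4) * fps_X ^ 4)"

lemma fps_power_nth_eq_0:
  fixes V :: "real fps"
  assumes "V $ 0 = 0" "V $ 1 = 0" "V $ 2 = 0" and "n < 3 * k"
  shows "(V ^ k) $ n = 0"
proof (cases "V = 0")
  case True
  with assms(4) show ?thesis by (cases k) auto
next
  case False
  have "subdegree V \<ge> 3"
  proof (rule subdegree_geI[OF False])
    fix i :: nat assume "i < 3"
    then have "i = 0 \<or> i = 1 \<or> i = 2" by auto
    with assms(1-3) show "V $ i = 0" by auto
  qed
  then have "n < k * subdegree V"
    using assms(4) by (metis mult.commute mult_le_mono2 order_less_le_trans)
  then have "n < subdegree (V ^ k)" by simp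
  then show ?thesis by (rule nth_less_subdegree_zero)
qed

lemma fps_power_lift_nth:
  "(Abs_fps (\<lambda>n. fls_const (V $ n :: real) / fls_X) ^ k) $ n = fls_const ((V ^ k) $ n) / fls_X ^ k"
proof (induction k arbitrary: n)
  case 0
  show ?case by (simp flip: fls_const_1)
next
  case (Suc k)
  have "(Abs_fps (\<lambda>n. fls_const (V $ n) / fls_X) ^ Suc k) $ n =
        (\<Sum>i=0..n. fls_const (V $ i * (V ^ k) $ (n - i)) / fls_X ^ Suc k)"
    by (simp only: power_Suc fps_mult_nth Suc fps_nth_Abs_fps times_divide_times_eq fls_const_mult_const)
  also have "\<dots> = (\<Sum>i=0..n. fls_const (V $ i * (V ^ k) $ (n - i))) / fls_X ^ Suc k"
    by (simp only: sum_divide_distrib)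
  also have "(\<Sum>i=0..n. fls_const (V $ i * (V ^ k) $ (n - i))) = fls_const ((V ^ Suc k) $ n)"
    by (simp add: fps_mult_nth fls_eq_iff fls_nth_sum)
  finally show ?case .
qed

lemma exp_over_hbar_nth:
  "exp_over_hbar V $ n = (\<Sum>k=0..n. fls_const ((V ^ k) $ n / fact k) / fls_X ^ k)"
proof -
  have "fps_nth (fps_exp 1) k * (fls_const x / y) = fls_const (x / fact k) / y"
    for k and x :: real and y :: "real fls"
  proof -
    have "fls_const (1 / fact k) * of_nat (fact k) = (1 :: real fls)"
      by (simp add: fls_of_nat)
    then have "fps_nth (fps_exp 1) k = (fls_const (1 / fact k) :: real fls)"
      unfolding fps_exp_def fps_nth_Abs_fps power_one
      by (metis nonzero_eq_divide_eq mult_zero_right zero_neq_one)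
    then show ?thesis
      by (simp only: times_divide_eq_right fls_const_mult_const) simp
  qed
  then show ?thesis
    unfolding exp_over_hbar_def fps_compose_nth fps_power_lift_nth by (simp only:)
qed


lemma formal_integral_term_eq:
  fixes V :: "real fps"
  assumes "V $ 0 = 0" "V $ 1 = 0" "V $ 2 = 0"
  shows "formal_integral_term a V n =
    (\<Sum>k | 3 * k \<le> 2 * n.
       fls_const (a ^ n * odd_double_fact n * (V ^ k) $ (2 * n) / fact k) * fls_X ^ (n - k))"
proof -
  have "exp_over_hbar V $ (2 * n) =
      (\<Sum>k | 3 * k \<le> 2 * n. fls_const ((V ^ k) $ (2 * n) / fact k) / fls_X ^ k)"
    unfolding exp_over_hbar_nth
    by (rule sum.mono_neutral_right) (auto simp: fps_power_nth_eq_0[OF assms])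
  then have "formal_integral_term a V n =
      (\<Sum>k | 3 * k \<le> 2 * n.
         (fls_const a * fls_X) ^ n * of_nat (odd_double_fact n)
           * (fls_const ((V ^ k) $ (2 * n) / fact k) / fls_X ^ k))"
    by (simp add: formal_integral_term_def sum_distrib_left)
  also have "\<dots> = (\<Sum>k | 3 * k \<le> 2 * n.
       fls_const (a ^ n * odd_double_fact n * (V ^ k) $ (2 * n) / fact k) * fls_X ^ (n - k))"
  proof (rule sum.cong)
    fix k assume "k \<in> {k. 3 * k \<le> 2 * n}"
    then have "k \<le> n" by simp
    then have X: "(fls_X :: real fls) ^ n = fls_X ^ (n - k) * fls_X ^ k"
      by (simp flip: power_add)
    have "(fls_const a * fls_X) ^ n * of_nat (odd_double_fact n)
           * (fls_const ((V ^ k) $ (2 * n) / fact k) / fls_X ^ k) =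
        fls_const a ^ n * of_nat (odd_double_fact n) * fls_const ((V ^ k) $ (2 * n) / fact k)
          * fls_X ^ (n - k)"
      unfolding power_mult_distrib X times_divide_eq_right
      by (subst nonzero_divide_eq_eq) (simp_all only: ac_simps, simp_all)
    also have "fls_const a ^ n * of_nat (odd_double_fact n) * fls_const ((V ^ k) $ (2 * n) / fact k) =
        fls_const (a ^ n * odd_double_fact n * (V ^ k) $ (2 * n) / fact k)"
      by (simp add: fls_of_nat flip: fls_const_power)
    finally show "(fls_const a * fls_X) ^ n * of_nat (odd_double_fact n)
           * (fls_const ((V ^ k) $ (2 * n) / fact k) / fls_X ^ k) =
        fls_const (a ^ n * odd_double_fact n * (V ^ k) $ (2 * n) / fact k) * fls_X ^ (n - k)" .
  qed simp
  finally show ?thesis .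
qed

lemma formal_integral_term_nth:
  fixes V :: "real fps"
  assumes "V $ 0 = 0" "V $ 1 = 0" "V $ 2 = 0"
  shows "fls_nth (formal_integral_term a V n) m =
    (\<Sum>k | 3 * k \<le> 2 * n \<and> int (n - k) = m.
       a ^ n * odd_double_fact n * (V ^ k) $ (2 * n) / fact k)"
proof -
  have fin: "finite {k. 3 * k \<le> 2 * n}"
    by (rule finite_subset[of _ "{..2*n}"]) auto
  have eq: "{k. 3 * k \<le> 2 * n \<and> int (n - k) = m} = {k \<in> {k. 3 * k \<le> 2 * n}. int (n - k) = m}"
    by auto
  show ?thesis
    unfolding formal_integral_term_eq[OF assms] fls_nth_sum eq sum.inter_filter[OF fin]
    by (intro sum.cong) auto
qed

lemma formal_integral_term_nth_eq_0:
  fixes V :: "real fps"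
  assumes "V $ 0 = 0" "V $ 1 = 0" "V $ 2 = 0" and "m < 0 \<or> 3 * m < int n"
  shows "fls_nth (formal_integral_term a V n) m = 0"
  unfolding formal_integral_term_nth[OF assms(1-3)] using assms(4) by (intro sum.neutral) auto

lemma formal_integral_term_sums:
  fixes V :: "real fps"
  assumes "V $ 0 = 0" "V $ 1 = 0" "V $ 2 = 0"
  shows "formal_integral_term a V sums
    fps_to_fls (Abs_fps (\<lambda>m. \<Sum>n\<le>3*m. fls_nth (formal_integral_term a V n) (int m)))" (is "?T sums fps_to_fls ?L")
  unfolding sums_def
proof (rule metric_LIMSEQ_I)
  fix r :: real assume "r > 0"
  then obtain M where M: "inverse (2 ^ M) < r"
    using real_arch_pow_inv[of r "1/2"] by (auto simp: power_one_over inverse_eq_divide)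
  have "dist (\<Sum>n<N. ?T n) (fps_to_fls ?L) < r" if N: "N > 3 * M" for N
  proof (cases "(\<Sum>n<N. ?T n) = fps_to_fls ?L")
    case False
    define D where "D = (\<Sum>n<N. ?T n) - fps_to_fls ?L"
    have "fls_nth D m = 0" if "m < int M" for m
    proof (cases "m < 0")
      case True
      then show ?thesis
        by (simp add: D_def fls_nth_sum formal_integral_term_nth_eq_0[OF assms])
    next
      case False
      then obtain j where j: "m = int j" by (metis nonneg_int_cases not_less)
      have "(\<Sum>n<N. fls_nth (?T n) (int j)) = (\<Sum>n\<le>3*j. fls_nth (?T n) (int j))"
        by (rule sum.mono_neutral_right)
           (use N j that in \<open>auto simp: formal_integral_term_nth_eq_0[OF assms]\<close>)
      then show ?thesis by (simp add: D_def fls_nth_sum j)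
    qed
    moreover have "D \<noteq> 0" using False by (simp add: D_def)
    ultimately have sub: "fls_subdegree D \<ge> int M" by (intro fls_subdegree_geI) auto
    then have "dist (\<Sum>n<N. ?T n) (fps_to_fls ?L) = inverse (2 ^ nat (fls_subdegree D))"
      using False by (simp add: dist_fls_def D_def)
    also have "\<dots> \<le> inverse (2 ^ M)"
      using sub by (intro le_imp_inverse_le power_increasing) auto
    finally show ?thesis using M by simp
  qed (use \<open>r > 0\<close> in simp)
  then show "\<exists>N0. \<forall>N\<ge>N0. dist (\<Sum>n<N. ?T n) (fps_to_fls ?L) < r"
    by (intro exI[of _ "Suc (3 * M)"]) auto
qed

lemma formal_integral_sums:
  fixes S V :: "real fps"
  assumes "V $ 0 = 0" "V $ 1 = 0" "V $ 2 = 0" and "a > 0"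
    and S: "S = - fps_const (1 / (2 * a)) * fps_X ^ 2 + V"
  shows "summable (formal_integral_term a V)"
    and "fps_to_fls (formal_integral S) = fls_const (sqrt a) * (\<Sum>n. formal_integral_term a V n)"
proof -
  show "summable (formal_integral_term a V)"
    using formal_integral_term_sums[OF assms(1-3)] by (rule sums_summable)
  have a: "- 1 / (2 * S $ 2) = a" and V: "S + fps_const (1 / (2 * a)) * fps_X ^ 2 = V"
    using assms by (simp_all add: S)
  have "formal_integral S = fls_regpart (fls_const (sqrt a) * (\<Sum>n. formal_integral_term a V n))"
    unfolding formal_integral_def Let_def a V ..
  moreover obtain L where "(\<Sum>n. formal_integral_term a V n) = fps_to_fls L"
    using formal_integral_term_sums[OF assms(1-3)] by (blast dest: sums_unique[symmetric])
  ultimately show "fps_to_fls (formal_integral S) =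
      fls_const (sqrt a) * (\<Sum>n. formal_integral_term a V n)"
    by (simp flip: fls_times_fps_to_fls fps_const_to_fls)
qed

end

(* With P(n) = (1/4)_n (3/4)_n / n!, both formal integrals are explicit: Z_0 has coefficients
   (2/3)^n P(n), and the double-well integral has coefficients (2/3)^n P(n) / sqrt 2, because the
   alternating sum for its m-th coefficient is, up to a factor, the m-th finite difference of the
   polynomial x (x+1) ... (x+2m-1) at x = 1/2. It remains to expand Gamma(1/4) Gamma(3/4) P(n) =
   Gamma(n+1/4) Gamma(n+3/4) / n! in the functions Gamma(n-k). The truncated expansion satisfies the
   recurrence of P(n) up to a single term of order Gamma(n+1-R), since the other terms telescope.
   So the error divided by P(n), which tends to 0, has increments dominated by those of
   Gamma(n-R) / Gamma(n), and therefore is itself dominated by this quotient. *)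

theory Submission
  imports Defs
begin

section \<open>Coefficients of a formal integral as finite sums\<close>

text \<open>The summand \<open>n\<close> contributes to the coefficient \<open>m\<close> only
  through \<open>V ^ k\<close> with k = n - m, and 3k \<le> 2n then says k \<le> 2m; so the double
  sum collapses to one over \<open>k\<close>.\<close>

lemma formal_integral_nth:
  fixes V :: "real fps"
  assumes V: "V $ 0 = 0" "V $ 1 = 0" "V $ 2 = 0" and a: "a > 0"
  shows "formal_integral (- fps_const (1 / (2 * a)) * fps_X ^ 2 + V) $ m =
    sqrt a * (\<Sum>k\<le>2*m. a ^ (m + k) * odd_double_fact (m + k) * (V ^ k) $ (2 * (m + k)) / fact k)"
proof -
  let ?S = "- fps_const (1 / (2 * a)) * fps_X ^ 2 + V"
  let ?L = "Abs_fps (\<lambda>m. \<Sum>n\<le>3*m. fls_nth (formal_integral_term a V n) (int m))"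
  let ?g = "\<lambda>k. a ^ (m + k) * odd_double_fact (m + k) * (V ^ k) $ (2 * (m + k)) / fact k"
  have "(\<Sum>n. formal_integral_term a V n) = fps_to_fls ?L"
    using formal_integral_term_sums[OF V] by (rule sums_unique[symmetric])
  then have "fps_to_fls (formal_integral ?S) = fps_to_fls (fps_const (sqrt a) * ?L)"
    using formal_integral_sums(2)[OF V a refl] by (simp add: fls_times_fps_to_fls)
  then have "formal_integral ?S $ m = sqrt a * (\<Sum>n\<le>3*m. fls_nth (formal_integral_term a V n) (int m))"
    by simp
  also have "(\<Sum>n\<le>3*m. fls_nth (formal_integral_term a V n) (int m)) =
      (\<Sum>n\<in>{m..3*m}. fls_nth (formal_integral_term a V n) (int m))"
    by (rule sum.mono_neutral_right) (auto simp: formal_integral_term_nth[OF V] intro!: sum.neutral)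
  also have "\<dots> = (\<Sum>n\<in>{m..3*m}. ?g (n - m))"
  proof (rule sum.cong)
    fix n assume n: "n \<in> {m..3*m}"
    show "fls_nth (formal_integral_term a V n) (int m) = ?g (n - m)"
    \<comment> \<open>For m > 0 the truncated difference determines k = n - m. For m = 0 it only
      says k \<ge> n, but there the range leaves just n = 0.\<close>
    proof (cases "m = 0")
      case True
      with n have "n = 0" by simp
      with True show ?thesis
        by (simp add: formal_integral_term_nth[OF V])
    next
      case False
      with n have "{k. 3 * k \<le> 2 * n \<and> int (n - k) = int m} = {n - m}"
        by auto
      with n show ?thesis
        unfolding formal_integral_term_nth[OF V] by simp
    qed
  qed simp
  also have "\<dots> = (\<Sum>k\<le>2*m. ?g k)"
    by (rule sum.reindex_bij_witness[where i = "\<lambda>k. k + m" and j = "\<lambda>n. n - m"]) auto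
  finally show ?thesis .
qed

lemma odd_double_fact_eq: "real (odd_double_fact n) = 2 ^ n * pochhammer (1/2) n"
proof (induction n)
  case (Suc n)
  have "real (odd_double_fact (Suc n)) = real (odd_double_fact n) * (2 * real n + 1)"
    by (simp add: odd_double_fact_def algebra_simps)
  with Suc.IH show ?case by (simp only:) (simp add: pochhammer_Suc algebra_simps)
qed (simp add: odd_double_fact_def)

section \<open>Finite differences of rising factorials\<close>

text \<open>Pascal's rule: a finite difference of order m + 1 at 0 is one of order m of the forward
  difference.\<close>

lemma sum_alternating_binomial_Suc:
  fixes f :: "nat \<Rightarrow> 'a :: comm_ring_1"
  shows "(\<Sum>j\<le>Suc m. (-1) ^ j * of_nat (Suc m choose j) * f (Suc m - j)) =
    (\<Sum>j\<le>m. (-1) ^ j * of_nat (m choose j) * (f (Suc (m - j)) - f (m - j)))"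
proof -
  \<comment> \<open>Padding with the zero term j = m + 1 and splitting off j = 0 aligns the indices
    for Pascal's rule.\<close>
  have "(\<Sum>j\<le>m. (-1) ^ j * of_nat (m choose j) * f (Suc (m - j))) =
      (\<Sum>j\<le>Suc m. (-1) ^ j * of_nat (m choose j) * f (Suc m - j))"
    by (simp add: Suc_diff_le binomial_eq_0)
  also have "\<dots> = f (Suc m) + (\<Sum>j\<le>m. (-1) ^ Suc j * of_nat (m choose Suc j) * f (m - j))"
    by (subst sum.atMost_Suc_shift) simp
  finally have A: "(\<Sum>j\<le>m. (-1) ^ j * of_nat (m choose j) * f (Suc (m - j))) = \<dots>" .
  show ?thesis
    by (subst sum.atMost_Suc_shift)
       (simp add: A binomial_eq_0 right_diff_distrib sum_subtractf sum.distrib sum_negf distrib_left distrib_right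
         left_diff_distrib)
qed

text \<open>The forward difference of y(y+1)...(y+N) is N + 1 times (y+1)...(y+N). Each of the m
  differences lowers the degree by one and moves the base point by one, which collects (m+d)!/d!.
  The case needed below is x = 1/2, d = m.\<close>

lemma sum_alternating_binomial_pochhammer:
  fixes x :: real
  shows "(\<Sum>j\<le>m. (-1) ^ j * of_nat (m choose j) * pochhammer (x + of_nat (m - j)) (m + d)) =
    fact (m + d) / fact d * pochhammer (x + of_nat m) d"
proof (induction m arbitrary: x)
  case (Suc m)
  have diff: "pochhammer (x + of_nat (Suc i)) (Suc m + d) - pochhammer (x + of_nat i) (Suc m + d) =
      real (Suc m + d) * pochhammer (x + 1 + of_nat i) (m + d)" for i
    using pochhammer_rec[of "x + real i" "m + d"] pochhammer_Suc[of "x + 1 + real i" "m + d"]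
    by (simp add: algebra_simps)
  have "(\<Sum>j\<le>Suc m. (-1) ^ j * of_nat (Suc m choose j) * pochhammer (x + of_nat (Suc m - j)) (Suc m + d)) =
     real (Suc m + d) * (\<Sum>j\<le>m. (-1) ^ j * of_nat (m choose j) * pochhammer (x + 1 + of_nat (m - j)) (m + d))"
    unfolding sum_alternating_binomial_Suc[of m "\<lambda>i. pochhammer (x + of_nat i) (Suc m + d)"] diff
    by (simp add: sum_distrib_left algebra_simps)
  also have "\<dots> = fact (Suc m + d) / fact d * pochhammer (x + of_nat (Suc m)) d"
    by (subst Suc.IH) (simp add: algebra_simps)
  finally show ?case .
qed simp

section \<open>Closed forms of the two formal integrals\<close>

text \<open>Powers of x^4/4! are monomials, so only k = m contributes, giving (4m-1)!! / (24^m m!).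
  The duplication formula for rising factorials then splits the double factorial.\<close>

lemma phi4_partition_function_nth:
  "phi4_partition_function $ m = (2/3) ^ m * (pochhammer (1/4) m * pochhammer (3/4) m / fact m)"
proof -
  let ?V = "fps_const (1 / fact 4) * fps_X ^ 4 :: real fps"
  have pow: "?V ^ k = fps_const ((1/24) ^ k) * fps_X ^ (4 * k)" for k
    by (simp add: power_mult_distrib fps_const_power fact_numeral flip: power_mult)
  have "phi4_partition_function $ m =
    (\<Sum>k\<le>2*m. odd_double_fact (m + k) * (?V ^ k) $ (2 * (m + k)) / fact k)"
    using formal_integral_nth[of ?V 1 m] by (simp add: phi4_partition_function_def)
  also have "\<dots> = (\<Sum>k\<in>{m}. odd_double_fact (m + k) * (?V ^ k) $ (2 * (m + k)) / fact k)"
    by (rule sum.mono_neutral_right) (auto simp: pow simp del: power_mult_distrib)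
  also have "\<dots> = odd_double_fact (2 * m) * (1/24) ^ m / fact m"
    by (simp add: pow flip: mult_2)
  also have "\<dots> = (4 ^ m * 4 ^ m * (1/24) ^ m) * (pochhammer (1/4) m * pochhammer (3/4) m / fact m)"
    using pochhammer_double[of "1/4 :: real" m] by (simp add: odd_double_fact_eq power_mult)
  also have "4 ^ m * 4 ^ m * (1/24) ^ m = (2/3 :: real) ^ m"
    unfolding power_mult_distrib[symmetric] by simp
  finally show ?thesis .
qed

lemma fps_linear_power_nth:
  fixes \<alpha> \<beta> :: "'a :: comm_ring_1"
  shows "((fps_const \<alpha> + fps_const \<beta> * fps_X) ^ k) $ j = of_nat (k choose j) * \<beta> ^ j * \<alpha> ^ (k - j)"
proof -
  have "(fps_const \<beta> * fps_X + fps_const \<alpha>) ^ k =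
      (\<Sum>i\<le>k. fps_const (of_nat (k choose i) * \<beta> ^ i * \<alpha> ^ (k - i)) * fps_X ^ i)"
    unfolding binomial_ring
    by (simp add: power_mult_distrib fps_const_power fps_of_nat algebra_simps flip: fps_const_mult)
  then show ?thesis
    by (simp add: fps_sum_nth add.commute if_distrib[of "\<lambda>x. _ * x"] sum.delta' binomial_eq_0 cong: if_cong)
qed

text \<open>With S the quartic action, this action is -(S(sqrt 6 - x) + 3/2): the expansion at a
  saddle point of S, where S has the value -3/2. Here a = 1/2, whence the factor 1/sqrt 2.\<close>

lemma double_well_formal_integral_nth:
  "formal_integral (- (fps_X ^ 2) + fps_const (1 / sqrt (fact 3)) * fps_X ^ 3
      - fps_const (1 / fact 4) * fps_X ^ 4) $ m =
    (2/3) ^ m * (pochhammer (1/4) m * pochhammer (3/4) m / fact m) / sqrt 2"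
proof -
  define \<alpha> \<beta> :: real where "\<alpha> = 1 / sqrt (fact 3)" and "\<beta> = - 1 / fact 4"
  define V where "V = fps_X ^ 3 * (fps_const \<alpha> + fps_const \<beta> * fps_X)"
  have pow: "(V ^ k) $ n = (if n < 3 * k then 0 else
      real (k choose (n - 3 * k)) * \<beta> ^ (n - 3 * k) * \<alpha> ^ (k - (n - 3 * k)))" for k n
    by (simp add: V_def power_mult_distrib fps_X_power_mult_nth fps_linear_power_nth flip: power_mult)
  have V0: "V $ 0 = 0" "V $ 1 = 0" "V $ 2 = 0"
    by (simp_all add: V_def fps_X_power_mult_nth)
  have S: "- (fps_X ^ 2) + fps_const (1 / sqrt (fact 3)) * fps_X ^ 3
      - fps_const (1 / fact 4) * fps_X ^ 4 = - fps_const (1 / (2 * (1/2))) * fps_X ^ 2 + V"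
    by (simp add: V_def \<alpha>_def \<beta>_def algebra_simps power_numeral_reduce flip: fps_const_neg)
  \<comment> \<open>Taking \<open>\<beta> * x\<close> from j of the k factors gives degree 3k + j,
    which is 2(m + k) exactly when k = 2m - j; then j \<le> k becomes j \<le> m.\<close>
  let ?g = "\<lambda>k. (1/2) ^ (m + k) * odd_double_fact (m + k) * (V ^ k) $ (2 * (m + k)) / fact k"
  let ?p = "\<lambda>j. (1/24) ^ m / fact m *
    ((-1) ^ j * real (m choose j) * pochhammer (1/2 + of_nat (m - j)) (m + m))"
  have g: "?g (2 * m - j) = ?p j" if "j \<le> m" for j
  proof -
    \<comment> \<open>There remain k - j = 2i factors \<open>\<alpha>\<close>, an even number, so
      the square root disappears.\<close>
    define i where "i = m - j"
    with that have m: "m = i + j" by simp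
    have Vc: "V ^ (2 * m - j) $ (2 * (m + (2 * m - j))) =
        real ((2 * i + j) choose j) * \<beta> ^ j * (1/6) ^ i"
    proof -
      have "\<alpha> ^ (2 * i) = (1/6) ^ i"
        by (simp add: \<alpha>_def power_mult power_divide fact_numeral)
      moreover have "2 * m - j = 2 * i + j" "2 * (m + (2 * m - j)) - 3 * (2 * m - j) = j"
          "\<not> 2 * (m + (2 * m - j)) < 3 * (2 * m - j)" "2 * i + j - j = 2 * i"
        by (simp_all add: m)
      ultimately show ?thesis by (simp only: pow if_False)
    qed
    \<comment> \<open>The rising factorial is split at i: its first part cancels against the one in
      (2i)!, its second is the value at 1/2 + i of the polynomial to be differenced.\<close>
    have odd: "(1/2) ^ (m + (2 * m - j)) * real (odd_double_fact (m + (2 * m - j))) =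
        pochhammer (1/2) i * pochhammer (1/2 + real i) (m + m)"
    proof -
      have e: "m + (2 * m - j) = i + (m + m)" by (simp add: m)
      show ?thesis
        unfolding e odd_double_fact_eq pochhammer_product'[symmetric] by (simp add: power_one_over)
    qed
    have choose: "real ((2 * i + j) choose j) / fact (2 * m - j) =
        1 / (fact j * (4 ^ i * pochhammer (1/2) i * fact i))"
    proof -
      have "real ((2 * i + j) choose j) = fact (2 * i + j) / (fact j * fact (2 * i))"
        by (subst binomial_fact) auto
      moreover have "2 * m - j = 2 * i + j" by (simp add: m)
      moreover have "fact (2 * i) = 4 ^ i * pochhammer (1/2 :: real) i * fact i"
        by (simp add: fact_double power_mult)
      ultimately show ?thesis by simp
    qed
    \<comment> \<open>Cubic and quartic weights combine to a power of 1/24 that no longer depends on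
      j, so only an alternating binomial sum remains.\<close>
    have const: "\<beta> ^ j * (1/6) ^ i / 4 ^ i = (-1) ^ j * (1/24) ^ m"
    proof -
      have "\<beta> ^ j = (-1) ^ j * (1/24) ^ j" "(1/24 :: real) ^ i = (1/6) ^ i * (1/4) ^ i"
        unfolding power_mult_distrib[symmetric] by (simp_all add: \<beta>_def fact_numeral)
      then show ?thesis by (simp add: m power_add power_one_over)
    qed
    have choose': "real (m choose j) / fact m = 1 / (fact i * fact j)"
      by (simp add: m binomial_fact)
    have nz: "pochhammer (1/2) i \<noteq> (0 :: real)"
      using pochhammer_pos[of "1/2 :: real" i] by simp
    have "?g (2 * m - j) = ((1/2) ^ (m + (2 * m - j)) * real (odd_double_fact (m + (2 * m - j)))) *
        (real ((2 * i + j) choose j) / fact (2 * m - j)) * (\<beta> ^ j * (1/6) ^ i)"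
      unfolding Vc by simp
    also have "\<dots> = pochhammer (1/2 + real i) (m + m) * (1 / (fact i * fact j)) * (\<beta> ^ j * (1/6) ^ i / 4 ^ i)"
      unfolding odd choose using nz by simp
    also have "\<dots> = pochhammer (1/2 + real i) (m + m) * (real (m choose j) / fact m) * ((-1) ^ j * (1/24) ^ m)"
      unfolding const choose' ..
    also have "\<dots> = ?p j"
      by (simp add: m)
    finally show ?thesis .
  qed
  have g': "?p (2 * m - k) = ?g k" if "m \<le> k" "k \<le> 2 * m" for k
    using g[of "2 * m - k"] that by simp
  have "(\<Sum>k\<le>2*m. ?g k) = (\<Sum>k\<in>{m..2*m}. ?g k)"
    by (rule sum.mono_neutral_right) (auto simp: pow binomial_eq_0)
  also have "\<dots> = (\<Sum>j\<le>m. ?p j)"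
    by (rule sum.reindex_bij_witness[where i = "\<lambda>j. 2 * m - j" and j = "\<lambda>k. 2 * m - k"])
       (use g' in auto)
  also have "\<dots> = (1/24) ^ m / fact m * (fact (m + m) / fact m * pochhammer (1/2 + of_nat m) m)"
    by (simp only: sum_alternating_binomial_pochhammer flip: sum_distrib_left)
  also have "fact (m + m) / fact m = 4 ^ m * pochhammer (1/2 :: real) m"
    by (simp add: fact_double power_mult flip: mult_2)
  also have "4 ^ m * pochhammer (1/2) m * pochhammer (1/2 + of_nat m) m =
      4 ^ m * pochhammer (1/2 :: real) (2 * m)"
    by (simp add: pochhammer_product' mult_2)
  also have "pochhammer (1/2 :: real) (2 * m) = 4 ^ m * pochhammer (1/4) m * pochhammer (3/4) m"
    using pochhammer_double[of "1/4 :: real" m] by (simp add: power_mult)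
  also have "(1/24) ^ m / fact m * (4 ^ m * (4 ^ m * pochhammer (1/4) m * pochhammer (3/4) m)) =
      (4 * 4 * (1/24)) ^ m * (pochhammer (1/4) m * pochhammer (3/4) m / fact m :: real)"
    unfolding power_mult_distrib by simp
  also have "(4 * 4 * (1/24)) ^ m = (2/3 :: real) ^ m" by simp
  finally have "(\<Sum>k\<le>2*m. ?g k) = (2/3) ^ m * (pochhammer (1/4) m * pochhammer (3/4) m / fact m)" .
  moreover have "sqrt (1/2 :: real) = 1 / sqrt 2" by (simp add: real_sqrt_divide)
  ultimately show ?thesis
    unfolding S by (subst formal_integral_nth[OF V0]) simp_all
qed

section \<open>Comparison of null sequences and ratios of Gamma values\<close>

text \<open>Both w - h and w + h decrease from \<open>N\<close> on and tend to 0, hence are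
  nonnegative there.\<close>

lemma abs_le_if_increments_le:
  fixes h w :: "nat \<Rightarrow> real"
  assumes "h \<longlonglongrightarrow> 0" "w \<longlonglongrightarrow> 0"
    and incr: "\<And>n. n \<ge> N \<Longrightarrow> \<bar>h (Suc n) - h n\<bar> \<le> w n - w (Suc n)" and "n \<ge> N"
  shows "\<bar>h n\<bar> \<le> w n"
proof -
  have lim: "(\<lambda>i. w (i + n) - h (i + n)) \<longlonglongrightarrow> 0 - 0" "(\<lambda>i. w (i + n) + h (i + n)) \<longlonglongrightarrow> 0 + 0"
    by (intro tendsto_intros LIMSEQ_ignore_initial_segment assms)+
  have dec: "decseq (\<lambda>i. w (i + n) - h (i + n))" "decseq (\<lambda>i. w (i + n) + h (i + n))"
  proof -
    have "\<bar>h (Suc (i + n)) - h (i + n)\<bar> \<le> w (i + n) - w (Suc (i + n))" for i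
      by (rule incr) (use \<open>n \<ge> N\<close> in simp)
    from this[unfolded abs_le_iff] show "decseq (\<lambda>i. w (i + n) - h (i + n))" "decseq (\<lambda>i. w (i + n) + h (i + n))"
      by (auto intro!: decseq_SucI simp: algebra_simps)
  qed
  show ?thesis
    using decseq_ge[OF dec(1) lim(1), of 0] decseq_ge[OF dec(2) lim(2), of 0] by simp
qed

text \<open>The inequality is strict because at n = k the left side is Gamma(1) = 1 while the right
  side is 0.\<close>

lemma Gamma_real_Suc_diff:
  assumes "k < n"
  shows "Gamma (real (Suc n) - real k) = (real n - real k) * Gamma (real n - real k)"
proof -
  have "x \<notin> \<int>\<^sub>\<le>\<^sub>0" if "x > 0" for x :: real
    using that by (auto simp: nonpos_Ints_def)
  then show ?thesis
    using Gamma_plus1[of "real n - real k"] assms by (simp add: algebra_simps)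
qed

text \<open>Raising \<open>k\<close> by one eventually divides the ratio by n - k - 1.\<close>

lemma tendsto_Gamma_ratio:
  "(\<lambda>n. Gamma (real n - real k) / Gamma (real n)) \<longlonglongrightarrow> (if k = 0 then 1 else 0)"
proof (induction k)
  case 0
  have "Gamma (real n) \<noteq> 0" if "n > 0" for n
    by (metis Gamma_real_pos of_nat_0_less_iff less_irrefl that)
  then have "eventually (\<lambda>n. Gamma (real n - real 0) / Gamma (real n) = 1) sequentially"
    by (intro eventually_mono[OF eventually_gt_at_top[of 0]]) simp
  then show ?case by (simp add: tendsto_eventually)
next
  case (Suc k)
  have "(\<lambda>n. 1 / (real n - real (Suc k))) \<longlonglongrightarrow> 0"
  proof -
    have "filterlim (\<lambda>n. - real (Suc k) + real n) at_top sequentially"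
      by (rule filterlim_tendsto_add_at_top[OF tendsto_const filterlim_real_sequentially])
    then have "filterlim (\<lambda>n. real n - real (Suc k)) at_infinity sequentially"
      by (simp only: filterlim_at_top_imp_at_infinity uminus_add_conv_diff)
    then show ?thesis by (rule tendsto_divide_0[OF tendsto_const])
  qed
  from tendsto_mult[OF Suc.IH this]
  have "(\<lambda>n. Gamma (real n - real k) / Gamma (real n) * (1 / (real n - real (Suc k)))) \<longlonglongrightarrow> 0"
    by simp
  moreover have "eventually (\<lambda>n. Gamma (real n - real k) / Gamma (real n) * (1 / (real n - real (Suc k))) =
      Gamma (real n - real (Suc k)) / Gamma (real n)) sequentially"
    using eventually_gt_at_top[of "Suc k"]
  proof eventually_elim
    case (elim n)
    then obtain m where "n = Suc m" "k < m" by (cases n) auto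
    with Gamma_real_Suc_diff[of k m] show ?case by simp
  qed
  ultimately have "(\<lambda>n. Gamma (real n - real (Suc k)) / Gamma (real n)) \<longlonglongrightarrow> 0"
    by (rule Lim_transform_eventually)
  then show ?case by simp
qed

section \<open>Expansion of Gamma(n+a) Gamma(n+1-a) / n! in the functions Gamma(n-k)\<close>

context
  fixes a :: real
  assumes a: "0 < a" "a < 1"
begin

private definition p :: "nat \<Rightarrow> real" where
  "p n = pochhammer a n * pochhammer (1 - a) n / fact n"

text \<open>Normalisation for which \<open>G * p n\<close> is Gamma(n+a) Gamma(n+1-a) / n!.\<close>

private definition G :: real where "G = Gamma a * Gamma (1 - a)"

text \<open>Error of the truncated expansion. Its coefficients are, up to sign, the numbers
  \<open>p k\<close> themselves.\<close>

private definition e :: "nat \<Rightarrow> nat \<Rightarrow> real" where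
  "e R n = G * p n - (\<Sum>k<R. (-1) ^ k * p k * Gamma (real n - real k))"

private lemma p_pos: "p n > 0"
  using a by (simp add: p_def pochhammer_pos)

private lemma G_pos: "G > 0"
  using a by (simp add: G_def Gamma_real_pos)

private lemma p_Suc: "real (Suc n) * p (Suc n) = (real n + a) * (real n + 1 - a) * p n"
proof -
  have "p (Suc n) = (a + real n) * (1 - a + real n) * p n / real (Suc n)"
    by (simp add: p_def pochhammer_Suc mult_ac del: of_nat_Suc)
  then show ?thesis
    by (simp add: field_simps del: of_nat_Suc)
qed

text \<open>Gauss's limits for Gamma(a) and Gamma(1-a): the powers n^a and n^(1-a) multiply to n, so
  the reciprocal of the product of both series, times n/(n+1), is p(n+1) / Gamma(n+1).\<close>

private lemma tendsto_p_Gamma: "(\<lambda>n. G * p n / Gamma (real n)) \<longlonglongrightarrow> 1"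
proof -
  have "(\<lambda>n. Gamma_series a n * Gamma_series (1 - a) n) \<longlonglongrightarrow> G"
    unfolding G_def by (intro tendsto_intros)
  then have "(\<lambda>n. G * (real n / real (Suc n)) * inverse (Gamma_series a n * Gamma_series (1 - a) n))
      \<longlonglongrightarrow> 1"
    by (rule tendsto_eq_rhs[OF tendsto_mult[OF tendsto_mult[OF tendsto_const LIMSEQ_n_over_Suc_n] tendsto_inverse]])
       (use G_pos in auto)
  moreover have "eventually (\<lambda>n. G * (real n / real (Suc n)) * inverse (Gamma_series a n * Gamma_series (1 - a) n) =
      G * p (Suc n) / Gamma (real (Suc n))) sequentially"
    using eventually_gt_at_top[of 0]
  proof eventually_elim
    case (elim n)
    have "exp (a * ln (real n)) * exp ((1 - a) * ln (real n)) = real n"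
      using elim by (simp add: algebra_simps flip: exp_add)
    then have "Gamma_series a n * Gamma_series (1 - a) n =
        fact n * fact n * real n / (pochhammer a (Suc n) * pochhammer (1 - a) (Suc n))"
      by (simp add: Gamma_series_def)
    moreover have "Gamma (real (Suc n)) = fact n"
      by (simp add: Gamma_fact)
    ultimately show ?case
      using elim by (simp add: p_def field_simps del: of_nat_Suc)
  qed
  ultimately have "(\<lambda>n. G * p (Suc n) / Gamma (real (Suc n))) \<longlonglongrightarrow> 1"
    by (rule Lim_transform_eventually)
  then show ?thesis by (rule LIMSEQ_imp_Suc)
qed

private lemma p_bounds:
  "eventually (\<lambda>n. Gamma (real n) / 2 \<le> G * p n \<and> G * p n \<le> 2 * Gamma (real n)) sequentially"
proof -
  have "eventually (\<lambda>n. G * p n / Gamma (real n) \<in> {1/2<..<2}) sequentially"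
    by (rule topological_tendstoD[OF tendsto_p_Gamma]) auto
  with eventually_gt_at_top[of 0] show ?thesis
    by eventually_elim (auto simp: field_simps Gamma_real_pos)
qed

text \<open>Induction on \<open>R\<close>, starting from the recurrence of \<open>p\<close>. When
  the next term is subtracted, all powers of n cancel and (R+a)(R+1-a) p(R) remains up to sign and
  Gamma(n-R). By the recurrence of \<open>p\<close> at \<open>R\<close> this is (R+1) p(R+1), the
  new single remainder; this is what dictates the coefficients.\<close>

private lemma e_Suc:
  assumes "n \<ge> R"
  shows "real (Suc n) * e R (Suc n) = (real n + a) * (real n + 1 - a) * e R n
    - real R * ((-1) ^ R * p R) * Gamma (real (Suc n) - real R)"
  using assms
proof (induction R)
  case 0
  then show ?case using p_Suc[of n] by (simp add: e_def)
next
  case (Suc R)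
  \<comment> \<open>Polynomial form of the induction step: \<open>E\<close>, \<open>E'\<close> stand
    for the errors at n and n + 1, \<open>q\<close>, \<open>q'\<close> for consecutive coefficients,
    \<open>g\<close> for Gamma(n-R).\<close>
  have step: "(x + 1) * (E' - q * ((x - r) * g)) = (x + a) * (x + 1 - a) * (E - q * g) - (r + 1) * q' * g"
    if "(x + 1) * E' = (x + a) * (x + 1 - a) * E - r * q * ((x - r) * g)"
      and "(r + 1) * q' = - ((r + a) * (r + 1 - a) * q)" for x r E E' q q' g :: real
    using that by algebra
  have e: "e (Suc R) i = e R i - (-1) ^ R * p R * Gamma (real i - real R)" for i
    by (simp add: e_def)
  have G: "Gamma (real (Suc n) - real R) = (real n - real R) * Gamma (real n - real R)"
    using Suc.prems by (intro Gamma_real_Suc_diff) simp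
  have "(real n + 1) * e R (Suc n) = (real n + a) * (real n + 1 - a) * e R n
    - real R * ((-1) ^ R * p R) * ((real n - real R) * Gamma (real n - real R))"
    using Suc unfolding G by (simp add: add.commute)
  moreover have "(real R + 1) * ((-1) ^ Suc R * p (Suc R)) =
      - ((real R + a) * (real R + 1 - a) * ((-1) ^ R * p R))"
    using arg_cong[OF p_Suc[of R], of "\<lambda>x. - ((-1) ^ R * x)"] by (simp add: algebra_simps)
  ultimately have "(real n + 1) * (e R (Suc n) - (-1) ^ R * p R * ((real n - real R) * Gamma (real n - real R))) =
      (real n + a) * (real n + 1 - a) * (e R n - (-1) ^ R * p R * Gamma (real n - real R))
        - (real R + 1) * ((-1) ^ Suc R * p (Suc R)) * Gamma (real n - real R)"
    by (rule step)
  then show ?case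
    unfolding e G by (simp add: add.commute)
qed

text \<open>The term k = 0 is Gamma(n) and cancels the leading behaviour of \<open>G * p n\<close>.
  For R = 0 the quotient is constantly 1.\<close>

private lemma tendsto_e:
  assumes "R > 0"
  shows "(\<lambda>n. e R n / (G * p n)) \<longlonglongrightarrow> 0"
proof -
  let ?S = "\<lambda>n. (\<Sum>k<R. (-1) ^ k * p k * (Gamma (real n - real k) / Gamma (real n)))"
  have "(\<lambda>n. 1 - ?S n * inverse (G * p n / Gamma (real n))) \<longlonglongrightarrow>
      1 - (\<Sum>k<R. (-1) ^ k * p k * (if k = 0 then 1 else 0)) * inverse 1"
    by (intro tendsto_intros tendsto_Gamma_ratio tendsto_p_Gamma) simp
  also have "(\<Sum>k<R. (-1) ^ k * p k * (if k = 0 then 1 else 0)) = (\<Sum>k\<in>{0::nat}. 1)"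
    by (rule sum.mono_neutral_cong_right) (use assms in \<open>auto simp: p_def\<close>)
  finally have "(\<lambda>n. 1 - ?S n * inverse (G * p n / Gamma (real n))) \<longlonglongrightarrow> 0" by simp
  moreover have "eventually (\<lambda>n. 1 - ?S n * inverse (G * p n / Gamma (real n)) = e R n / (G * p n)) sequentially"
    using eventually_gt_at_top[of 0]
  proof eventually_elim
    case (elim n)
    then have "Gamma (real n) > 0" by (simp add: Gamma_real_pos)
    then show ?case
      using G_pos p_pos[of n] by (simp add: e_def field_simps flip: sum_divide_distrib)
  qed
  ultimately show ?thesis by (rule Lim_transform_eventually)
qed

lemma pochhammer_expansion_Gamma:
  "(\<lambda>n. Gamma a * Gamma (1 - a) * (pochhammer a n * pochhammer (1 - a) n / fact n)
      - (\<Sum>k<R. (-1) ^ k * (pochhammer a k * pochhammer (1 - a) k / fact k) * Gamma (real n - real k)))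
    \<in> O(\<lambda>n. Gamma (real n - real R))"
proof -
  obtain N0 where N0: "\<And>n. n \<ge> N0 \<Longrightarrow> Gamma (real n) / 2 \<le> G * p n \<and> G * p n \<le> 2 * Gamma (real n)"
    using p_bounds by (auto simp: eventually_at_top_linorder)
  \<comment> \<open>Beyond \<open>N\<close> the bounds on \<open>p\<close> hold and n > R, so
    Gamma(n-R) is positive.\<close>
  define N where "N = max N0 (Suc R)"
  \<comment> \<open>The 2 comes from the lower bound Gamma(n+1)/2 for G p(n+1).\<close>
  define D where "D = 2 * p R"
  define w where "w n = D * (Gamma (real n - real R) / Gamma (real n))" for n
  define h where "h n = e R n / (G * p n)" for n
  have incr: "\<bar>h (Suc n) - h n\<bar> \<le> w n - w (Suc n)" if n: "n \<ge> N" for n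
  proof -
    have pos: "Gamma (real n - real R) > 0" "Gamma (real n) > 0" "Gamma (real (Suc n)) > 0"
      using n by (auto intro!: Gamma_real_pos simp: N_def)
    have Gp: "G * p (Suc n) \<ge> Gamma (real (Suc n)) / 2" "G * p (Suc n) > 0"
      using n N0[of "Suc n"] G_pos p_pos[of "Suc n"] by (auto simp: N_def)
    have S: "Gamma (real (Suc n) - real R) = (real n - real R) * Gamma (real n - real R)"
        "Gamma (real (Suc n)) = real n * Gamma (real n)"
      using n Gamma_real_Suc_diff[of R n] Gamma_real_Suc_diff[of 0 n] by (simp_all add: N_def)
    \<comment> \<open>The recurrence of \<open>p\<close> puts \<open>h n\<close> over the
      denominator of \<open>h (Suc n)\<close>; the homogeneous parts then cancel in the
      difference.\<close>
    have hn: "h n = (real n + a) * (real n + 1 - a) * e R n / (real (Suc n) * (G * p (Suc n)))"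
    proof -
      have "real (Suc n) * (G * p (Suc n)) = ((real n + a) * (real n + 1 - a)) * (G * p n)"
        using p_Suc[of n] by (simp only: mult.left_commute[of _ G])
      moreover have nz: "(real n + a) * (real n + 1 - a) \<noteq> 0" using a by simp
      ultimately show ?thesis by (simp only: h_def mult_divide_mult_cancel_left[OF nz])
    qed
    have hSuc: "h (Suc n) = real (Suc n) * e R (Suc n) / (real (Suc n) * (G * p (Suc n)))"
      by (simp add: h_def)
    have "h (Suc n) - h n =
        - (real R * ((-1) ^ R * p R) * Gamma (real (Suc n) - real R)) / (real (Suc n) * (G * p (Suc n)))"
    proof -
      have "R \<le> n" using n by (simp add: N_def)
      from e_Suc[OF this] show ?thesis
        unfolding hn hSuc diff_divide_distrib[symmetric] by simp
    qed
    then have "\<bar>h (Suc n) - h n\<bar> =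
        real R * p R * ((real n - real R) * Gamma (real n - real R)) / (real (Suc n) * (G * p (Suc n)))"
      using n pos Gp p_pos[of R] G_pos p_pos[of "Suc n"] unfolding S(1)
      by (simp add: abs_mult power_abs N_def del: of_nat_Suc)
    also have "\<dots> \<le> real R * p R * (real (Suc n) * Gamma (real n - real R)) / (real (Suc n) * (Gamma (real (Suc n)) / 2))"
      using pos Gp p_pos[of R] n
      by (intro frac_le mult_left_mono mult_right_mono mult_pos_pos mult_nonneg_nonneg) (auto simp: N_def)
    also have "\<dots> = D * (real R * Gamma (real n - real R) / Gamma (real (Suc n)))"
      using pos by (simp add: D_def field_simps del: of_nat_Suc)
    also have "\<dots> = w n - w (Suc n)"
    proof -
      \<comment> \<open>With r = R, y = n: R Gamma(n-R) / Gamma(n+1) is exactly the decrease of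
        Gamma(n-R) / Gamma(n) from n to n + 1.\<close>
      have "D * (r * x / (y * g)) = D * (x / g) - D * ((y - r) * x / (y * g))"
        if "y > 0" "g > 0" for x y g r :: real
        using that by (simp add: field_simps)
      moreover have "real n > 0" using n by (simp add: N_def)
      ultimately show ?thesis
        unfolding w_def S using pos(2) by blast
    qed
    finally show ?thesis .
  qed
  have "\<bar>e R n\<bar> \<le> (if R = 0 then 2 else 2 * D) * \<bar>Gamma (real n - real R)\<bar>" if n: "n \<ge> N" for n
  \<comment> \<open>For R = 0 the error is \<open>G * p n\<close>, bounded directly; comparison
    needs \<open>h\<close> and \<open>w\<close> to tend to 0, hence R > 0.\<close>
  proof (cases "R = 0")
    case True
    with N0[of n] n G_pos p_pos[of n] show ?thesis by (simp add: e_def N_def abs_mult)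
  next
    case False
    have pos: "Gamma (real n - real R) > 0" "Gamma (real n) > 0"
      using n by (auto intro!: Gamma_real_pos simp: N_def)
    have "w \<longlonglongrightarrow> D * 0"
      unfolding w_def using tendsto_Gamma_ratio[of R] False by (intro tendsto_mult) simp_all
    then have "\<bar>h n\<bar> \<le> w n"
      using abs_le_if_increments_le[of h w N n] incr n tendsto_e[of R, folded h_def] False by simp
    then have "\<bar>h n\<bar> * (G * p n) \<le> w n * (2 * Gamma (real n))"
      by (rule mult_mono) (use N0[of n] n G_pos p_pos[of n] \<open>\<bar>h n\<bar> \<le> w n\<close> in \<open>auto simp: N_def\<close>)
    also have "w n * (2 * Gamma (real n)) = 2 * D * \<bar>Gamma (real n - real R)\<bar>"
      using pos by (simp add: w_def)
    also have "\<bar>h n\<bar> * (G * p n) = \<bar>e R n\<bar>"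
      using G_pos p_pos[of n] by (simp add: h_def abs_mult)
    finally show ?thesis using False by simp
  qed
  then have "e R \<in> O(\<lambda>n. Gamma (real n - real R))"
    by (intro bigoI eventually_sequentiallyI[of N]) simp
  then show ?thesis
    unfolding e_def G_def p_def by simp
qed

end

section \<open>The reflection constant and the conclusion\<close>

text \<open>Euler's reflection formula at 1/4, applied over the complex numbers and carried back to
  the reals.\<close>

lemma Gamma_one_fourth_mult_three_fourths: "Gamma (1/4) * Gamma (3/4) = (pi * sqrt 2 :: real)"
proof -
  have "complex_of_real (Gamma (1/4) * Gamma (3/4)) = complex_of_real (pi / sin (pi / 4))"
    using Gamma_reflection_complex[of "complex_of_real (1/4)"]
    by (simp flip: Gamma_complex_of_real sin_of_real)
  then have "Gamma (1/4) * Gamma (3/4) = pi / sin (pi / 4)"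
    by (simp only: of_real_eq_iff)
  then have "sqrt 2 * (Gamma (1/4) * Gamma (3/4)) = sqrt 2 * (pi * sqrt 2)"
    by (simp add: sin_45 field_simps)
  then show ?thesis by simp
qed

theorem mainTheorem8:
  fixes c :: "real fps"
  assumes c_def: "c = fps_const (1 / pi) *
    fps_compose
      (formal_integral
        (- (fps_X ^ 2) + fps_const (1 / sqrt (fact 3)) * fps_X ^ 3
          - fps_const (1 / fact 4) * fps_X ^ 4))
      (- fps_X)"
  shows "(\<forall>R :: nat.
      (\<lambda>n. fps_nth phi4_partition_function n
            - (\<Sum>k<R. fps_nth c k * (3 / 2) powi (- int n + int k) * Gamma (real n - real k)))
        \<in> O(\<lambda>n. (3 / 2) powi (- int n) * Gamma (real n - real R)))
    \<and> fps_cutoff 5 c =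
      fps_const (1 / (sqrt 2 * pi)) *
        (1 - fps_const (1 / 8) * fps_X + fps_const (35 / 384) * fps_X ^ 2
           - fps_const (385 / 3072) * fps_X ^ 3 + fps_const (25025 / 98304) * fps_X ^ 4)"
proof (intro conjI allI)
  let ?P = "\<lambda>n. pochhammer (1/4) n * pochhammer (3/4) n / fact n :: real"
  have c: "c $ k = (-1) ^ k * ((2/3) ^ k * ?P k) / (sqrt 2 * pi)" for k
    unfolding c_def fps_mult_left_const_nth fps_compose_uminus' fps_nth_Abs_fps
      double_well_formal_integral_nth by simp
  show "(\<lambda>n. phi4_partition_function $ n
      - (\<Sum>k<R. c $ k * (3 / 2) powi (- int n + int k) * Gamma (real n - real k)))
    \<in> O(\<lambda>n. (3 / 2) powi (- int n) * Gamma (real n - real R))" for R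
  proof -
    \<comment> \<open>The expansion at a = 1/4; multiplied by (2/3)^n / (sqrt 2 pi) it becomes the
      claimed one.\<close>
    let ?E = "\<lambda>n. pi * sqrt 2 * ?P n - (\<Sum>k<R. (-1) ^ k * ?P k * Gamma (real n - real k))"
    have powi: "(3/2 :: real) powi (- int n) = (2/3) ^ n" for n
      by (simp add: power_int_minus flip: power_inverse)
    have powi_add: "(3/2 :: real) powi (- int n + int k) = (2/3) ^ n * (3/2) ^ k" for n k
      by (subst power_int_add) (simp_all add: powi)
    have rearrange: "s * (x * q) / d * (z * y) * g = x * y * (z / d * (s * q * g))"
      for s x q d z y g :: real by simp
    \<comment> \<open>The factor (3/2)^k of the claimed expansion cancels the (2/3)^k in
      \<open>c $ k\<close>.\<close>
    have "(2/3 :: real) ^ k * (3/2) ^ k = 1" for k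
      by (simp flip: power_mult_distrib)
    then have term_eq: "c $ k * (3 / 2) powi (- int n + int k) * Gamma (real n - real k) =
        (2/3) ^ n / (sqrt 2 * pi) * ((-1) ^ k * ?P k * Gamma (real n - real k))" for n k
      unfolding c powi_add rearrange by simp
    have "?E \<in> O(\<lambda>n. Gamma (real n - real R))"
      using pochhammer_expansion_Gamma[of "1/4" R] by (simp add: Gamma_one_fourth_mult_three_fourths)
    then have "(\<lambda>n. (2/3) ^ n / (sqrt 2 * pi) * ?E n) \<in> O(\<lambda>n. (2/3) ^ n / (sqrt 2 * pi) * Gamma (real n - real R))"
      by (intro landau_o.big.mult landau_o.big_refl)
    then have "(\<lambda>n. (2/3) ^ n / (sqrt 2 * pi) * ?E n) \<in> O(\<lambda>n. (2/3) ^ n * Gamma (real n - real R))"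
      by simp
    also have "(\<lambda>n. (2/3) ^ n / (sqrt 2 * pi) * ?E n) = (\<lambda>n. phi4_partition_function $ n
      - (\<Sum>k<R. c $ k * (3 / 2) powi (- int n + int k) * Gamma (real n - real k)))"
      unfolding term_eq sum_distrib_left[symmetric] phi4_partition_function_nth
      by (simp add: right_diff_distrib)
    finally show ?thesis unfolding powi .
  qed
  show "fps_cutoff 5 c =
      fps_const (1 / (sqrt 2 * pi)) *
        (1 - fps_const (1 / 8) * fps_X + fps_const (35 / 384) * fps_X ^ 2
           - fps_const (385 / 3072) * fps_X ^ 3 + fps_const (25025 / 98304) * fps_X ^ 4)"
  proof (rule fps_ext)
    fix n :: nat
    have pochhammer_numeral: "pochhammer x 2 = x * (x + 1)" "pochhammer x 3 = x * (x + 1) * (x + 2)"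
        "pochhammer x 4 = x * (x + 1) * (x + 2) * (x + 3)" for x :: real
      by (simp_all add: eval_nat_numeral pochhammer_Suc add_ac)
    \<comment> \<open>From index 5 on both sides vanish, so five coefficients remain to be
      computed.\<close>
    consider "n = 0" | "n = 1" | "n = 2" | "n = 3" | "n = 4" | "n \<ge> 5" by linarith
    then show "fps_cutoff 5 c $ n = (fps_const (1 / (sqrt 2 * pi)) *
        (1 - fps_const (1 / 8) * fps_X + fps_const (35 / 384) * fps_X ^ 2
           - fps_const (385 / 3072) * fps_X ^ 3 + fps_const (25025 / 98304) * fps_X ^ 4)) $ n"
      by cases (simp_all add: c pochhammer_numeral fact_numeral fps_X_power_nth fps_X_nth power_divide)
  qed
qed

end
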